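(* Let $m,n,p\ge3$ and let $M,N,P$ be the languages recognized by $W_m(a,c,b,d)$, $W_n(a,b,c,d)$ and $W_p(d,b,c,a)$ respectively (these have state complexities $m,n,p$). Then $$\mathrm{sc}(M\cdot(N\oplus P))=(m-1)\alpha_{n,p}+\alpha'_{n,p}.$$ Consequently (with the general upper bound) the state complexity of the ternary operation $(L_1,L_2,L_3)\mapsto L_1\cdot(L_2\oplus L_3)$ at $(m,n,p)$ is $(m-1)\alpha_{n,p}+\alpha'_{n,p}$.
   Context: Alphabet $\Sigma=\{a,b,c,d\}$. For distinct symbols $x_1,x_2,x_3,x_4$, $W_k(x_1,x_2,x_3,x_4)$ is the complete DFA with states $\{0,\dots,k-1\}$, initial state $0$, unique final state $k-1$, where $x_1$ acts as the cycle $j\mapsto j+1\bmod k$, $x_2$ swaps $k-2$ and $k-1$ and fixes the other states, $x_3$ sends $1$ to $0$ and fixes the other states, and $x_4$ acts as the identity. $\mathrm{sc}(L)$ is the number of states of the minimal complete DFA of $L$; $\oplus$ is symmetric difference. An $n\times p$ tableau is a set of marked cells of an $n\times p$ grid; it is saturated if whenever cells $(x,x'),(x,y'),(y,y')$ are marked then $(y,x')$ is marked. $\alpha_{n,p}$ is the number of saturated $n\times p$ tableaux and $\alpha'_{n,p}$ the number of saturated $n\times p$ tableaux in which a fixed given cell is marked. The state complexity of a ternary operation at $(m,n,p)$ is the maximum of $\mathrm{sc}$ of the result over all languages with state complexities $m,n,p$. *)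

theory Defs
  imports Main
begin

datatype sigma = a | b | c | d

type_synonym 'x lang = "'x list set"

definition is_dfa :: "nat \<Rightarrow> (nat \<Rightarrow> 'x \<Rightarrow> nat) \<Rightarrow> nat \<Rightarrow> nat set \<Rightarrow> bool" where
  "is_dfa k delta q0 F \<longleftrightarrow> q0 < k \<and> F \<subseteq> {..<k} \<and> (\<forall>q<k. \<forall>x. delta q x < k)"

definition dfa_lang :: "(nat \<Rightarrow> 'x \<Rightarrow> nat) \<Rightarrow> nat \<Rightarrow> nat set \<Rightarrow> 'x lang" where
  "dfa_lang delta q0 F = {w. foldl delta q0 w \<in> F}"

definition regular :: "'x lang \<Rightarrow> bool" where
  "regular L \<longleftrightarrow> (\<exists>k delta q0 F. is_dfa k delta q0 F \<and> dfa_lang delta q0 F = L)"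

definition sc :: "'x lang \<Rightarrow> nat" where
  "sc L = (LEAST k. \<exists>delta q0 F. is_dfa k delta q0 F \<and> dfa_lang delta q0 F = L)"

definition conc :: "'x lang \<Rightarrow> 'x lang \<Rightarrow> 'x lang" where
  "conc L1 L2 = {u @ v | u v. u \<in> L1 \<and> v \<in> L2}"

definition symdiff :: "'x lang \<Rightarrow> 'x lang \<Rightarrow> 'x lang" where
  "symdiff L1 L2 = (L1 - L2) \<union> (L2 - L1)"

text \<open>Transition function of W_k(x1,x2,x3,x4) (the x_i are assumed distinct).\<close>
definition W_delta :: "nat \<Rightarrow> 'x \<Rightarrow> 'x \<Rightarrow> 'x \<Rightarrow> 'x \<Rightarrow> nat \<Rightarrow> 'x \<Rightarrow> nat" where
  "W_delta k x1 x2 x3 x4 q x =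
     (if x = x1 then (q + 1) mod k
      else if x = x2 then (if q = k - 2 then k - 1 else if q = k - 1 then k - 2 else q)
      else if x = x3 then (if q = 1 then 0 else q)
      else q)"

definition W_lang :: "nat \<Rightarrow> 'x \<Rightarrow> 'x \<Rightarrow> 'x \<Rightarrow> 'x \<Rightarrow> 'x lang" where
  "W_lang k x1 x2 x3 x4 = dfa_lang (W_delta k x1 x2 x3 x4) 0 {k - 1}"

text \<open>Tableaux: sets of marked cells of the n x p grid {0..<n} x {0..<p}.\<close>
definition saturated :: "(nat \<times> nat) set \<Rightarrow> bool" where
  "saturated T \<longleftrightarrow> (\<forall>x y x' y'. (x, x') \<in> T \<and> (x, y') \<in> T \<and> (y, y') \<in> T \<longrightarrow> (y, x') \<in> T)"

definition alpha :: "nat \<Rightarrow> nat \<Rightarrow> nat" where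
  "alpha n p = card {T. T \<subseteq> {..<n} \<times> {..<p} \<and> saturated T}"

text \<open>Fixed given cell: (n-1, p-1) (the count does not depend on the cell by symmetry).\<close>
definition alpha' :: "nat \<Rightarrow> nat \<Rightarrow> nat" where
  "alpha' n p = card {T. T \<subseteq> {..<n} \<times> {..<p} \<and> saturated T \<and> (n - 1, p - 1) \<in> T}"

end

theory Submission
  imports Defs "HOL-Combinatorics.Transposition"
begin

text \<open>
  A deterministic automaton for \<open>L\<^sub>1 \<cdot> (L\<^sub>2 \<oplus> L\<^sub>3)\<close> has states \<open>(q, S)\<close>, where \<open>q\<close> is a state
  of the first automaton and \<open>S\<close> a tableau of pairs of states of the other two; the pair of
  initial states is added whenever \<open>q\<close> becomes final. The tableau is tested only by asking, for a
  2-colouring of rows and of columns, whether some marked cell has a row and a column of different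
  colours. The cells whose row and column agree form a saturated tableau, so \<open>S\<close> may be replaced
  by its saturation, which gives the upper bound.

  For the witnesses, when the first automaton is in state \<open>0\<close>, rows and columns can be rotated
  independently, and a full turn of the first automaton marks a cell, so every tableau is reached.
  The letters \<open>b\<close> and \<open>c\<close> act simultaneously on rows and columns, but commutators with rotations
  decouple them, so that every pair of colourings is realised by a word; these separate distinct
  saturated tableaux.
\<close>

subsection \<open>Residuals\<close>

text \<open>Left quotients, that is, Myhill-Nerode classes: their number is the size of the minimal
  complete DFA.\<close>

definition residual :: "'x lang \<Rightarrow> 'x list \<Rightarrow> 'x lang" where
  "residual L w = {v. w @ v \<in> L}"

lemma residuals_subset_states:
  assumes "is_dfa k delta q0 F" "dfa_lang delta q0 F = L"
  shows "range (residual L) \<subseteq> (\<lambda>q. dfa_lang delta q F) ` {..<k}"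
proof
  fix K assume "K \<in> range (residual L)"
  then obtain w where K: "K = residual L w" by blast
  have "foldl delta q0 w < k"
    by (induction w rule: rev_induct) (use assms in \<open>auto simp: is_dfa_def\<close>)
  moreover have "K = dfa_lang delta (foldl delta q0 w) F"
    using K assms(2) by (auto simp: residual_def dfa_lang_def)
  ultimately show "K \<in> (\<lambda>q. dfa_lang delta q F) ` {..<k}" by blast
qed

text \<open>The residuals themselves serve as states, a letter acting by a further quotient;
  \<open>h\<close> numbers them because the states in \<open>is_dfa\<close> are an initial segment
  of the naturals.\<close>

lemma dfa_of_residuals:
  assumes "finite (range (residual L))"
  shows "\<exists>delta q0 F. is_dfa (card (range (residual L))) delta q0 F \<and> dfa_lang delta q0 F = L"
proof -
  let ?R = "range (residual L)"
  obtain h where h: "bij_betw h ?R {..<card ?R}"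
    using ex_bij_betw_finite_nat[OF assms] by (auto simp: atLeast0LessThan)
  define g where "g = inv_into ?R h"
  define delta where "delta i x = h {v. x # v \<in> g i}" for i x
  have gh: "g (h (residual L w)) = residual L w" for w
    using h by (simp add: g_def bij_betw_inv_into_left)
  have snoc: "{v. x # v \<in> residual L w} = residual L (w @ [x])" for x w
    by (simp add: residual_def)
  have hlt: "h (residual L w) < card ?R" for w
    using h by (auto simp: bij_betw_def)
  have fold: "foldl delta (h (residual L [])) w = h (residual L w)" for w
    by (induction w rule: rev_induct) (simp_all add: delta_def gh snoc)
  define F where "F = h ` {K \<in> ?R. [] \<in> K}"
  have "is_dfa (card ?R) delta (h (residual L [])) F"
    unfolding is_dfa_def
  proof (intro conjI allI impI)
    show "h (residual L []) < card ?R" by (rule hlt)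
    show "F \<subseteq> {..<card ?R}" unfolding F_def using hlt by auto
    fix q x assume "q < card ?R"
    then have "g q \<in> ?R" unfolding g_def using h
      by (metis bij_betw_def inv_into_into lessThan_iff)
    then obtain w where "g q = residual L w" by blast
    then show "delta q x < card ?R" by (simp add: delta_def snoc hlt)
  qed
  moreover have "dfa_lang delta (h (residual L [])) F = L"
  proof -
    have "h (residual L w) \<in> F \<longleftrightarrow> [] \<in> residual L w" for w
    proof
      assume "h (residual L w) \<in> F"
      then obtain u where "h (residual L w) = h (residual L u)" "[] \<in> residual L u"
        unfolding F_def by auto
      then show "[] \<in> residual L w" by (metis gh)
    qed (auto simp: F_def)
    then show ?thesis unfolding dfa_lang_def fold by (simp add: residual_def)
  qed
  ultimately show ?thesis by blast
qed

lemma sc_eq_card_residuals: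
  assumes "finite (range (residual L))"
  shows "sc L = card (range (residual L))"
  unfolding sc_def
proof (rule Least_equality)
  show "\<exists>delta q0 F. is_dfa (card (range (residual L))) delta q0 F \<and> dfa_lang delta q0 F = L"
    using assms by (rule dfa_of_residuals)
  fix k assume "\<exists>delta q0 F. is_dfa k delta q0 F \<and> dfa_lang delta q0 F = L"
  then obtain delta q0 F where "range (residual L) \<subseteq> (\<lambda>q. dfa_lang delta q F) ` {..<k}"
    using residuals_subset_states by metis
  then show "card (range (residual L)) \<le> k"
    using surj_card_le[of "{..<k}" "range (residual L)"] by simp
qed

lemma dfa_with_sc_states:
  assumes "regular L"
  obtains delta q0 F where "is_dfa (sc L) delta q0 F" "dfa_lang delta q0 F = L"
proof -
  have "\<exists>k delta q0 F. is_dfa k delta q0 F \<and> dfa_lang delta q0 F = L"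
    using assms by (simp add: regular_def)
  then have "\<exists>delta q0 F. is_dfa (sc L) delta q0 F \<and> dfa_lang delta q0 F = L"
    unfolding sc_def by (rule LeastI_ex)
  then show ?thesis using that by blast
qed

subsection \<open>Saturated tableaux\<close>

definition saturation :: "(nat \<times> nat) set \<Rightarrow> (nat \<times> nat) set" where
  "saturation S = \<Inter> {T. S \<subseteq> T \<and> saturated T}"

lemma saturatedD: "saturated T \<Longrightarrow> (x, x') \<in> T \<Longrightarrow> (x, y') \<in> T \<Longrightarrow> (y, y') \<in> T \<Longrightarrow> (y, x') \<in> T"
  unfolding saturated_def by (elim allE) (erule mp, simp)

lemma saturated_saturation: "saturated (saturation S)"
  unfolding saturation_def saturated_def[of "\<Inter> _"]
  by (intro allI impI InterI) (simp, metis saturatedD)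

lemma subset_saturation: "S \<subseteq> saturation S"
  unfolding saturation_def by blast

lemma saturation_least: "S \<subseteq> T \<Longrightarrow> saturated T \<Longrightarrow> saturation S \<subseteq> T"
  unfolding saturation_def by blast

lemma saturated_Times: "saturated (A \<times> B)"
  unfolding saturated_def by blast

text \<open>Three corners of a rectangle force the colours of its two rows and two columns to
  agree.\<close>

lemma saturated_equal_colour: "saturated {(i, j). f i = g j}"
  unfolding saturated_def by auto

text \<open>Injectivity pulls three corners of a rectangle in the image back to three corners in
  \<open>S\<close>; a map merging lines could create new rectangles.\<close>

lemma saturated_image:
  assumes "inj_on f A" "inj_on g B" "S \<subseteq> A \<times> B" "saturated S"
  shows "saturated (map_prod f g ` S)"
  unfolding saturated_def
proof (intro allI impI, elim conjE)
  fix x y x' y'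
  assume "(x, x') \<in> map_prod f g ` S" "(x, y') \<in> map_prod f g ` S" "(y, y') \<in> map_prod f g ` S"
  then obtain i1 j1 i2 j2 i3 j3 where
    S: "(i1, j1) \<in> S" "(i2, j2) \<in> S" "(i3, j3) \<in> S" and
    e: "x = f i1" "x' = g j1" "x = f i2" "y' = g j2" "y = f i3" "y' = g j3"
    by (auto simp: map_prod_def)
  have "i1 = i2" "j2 = j3"
    using S e assms(1-3) by (auto dest: inj_onD)
  then have "(i3, j1) \<in> S" using S assms(4) by (metis saturatedD)
  then show "(y, x') \<in> map_prod f g ` S" using e by force
qed

text \<open>A cell outside a saturated tableau can be split off by a colouring of rows and columns
  that is constant on each marked cell: one colour class is the connected component of
  row \<open>i\<close> in the bipartite graph given by the tableau.\<close>

lemma separating_colouring: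
  assumes "saturated T" "(i, j) \<notin> T"
  obtains R C where "\<And>x y. (x, y) \<in> T \<Longrightarrow> x \<in> R \<longleftrightarrow> y \<in> C" "i \<in> R" "j \<notin> C"
    "C = {} \<Longrightarrow> R = {i}" "\<And>y. y \<in> C \<Longrightarrow> (i, y) \<in> T"
proof (rule that)
  let ?C = "{y. (i, y) \<in> T}"
  let ?R = "{x. \<exists>y\<in>?C. (x, y) \<in> T} \<union> {i}"
  show "x \<in> ?R \<longleftrightarrow> y \<in> ?C" if "(x, y) \<in> T" for x y
    using that assms(1) by (auto dest: saturatedD)
qed (use assms in auto)

abbreviation tableaux :: "nat \<Rightarrow> nat \<Rightarrow> (nat \<times> nat) set set" where
  "tableaux n p \<equiv> {T. T \<subseteq> {..<n} \<times> {..<p} \<and> saturated T}"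

lemma finite_tableaux: "finite (tableaux n p)"
  by (rule finite_subset[of _ "Pow ({..<n} \<times> {..<p})"]) auto

lemma alpha'_le_alpha: "alpha' n p \<le> alpha n p"
  unfolding alpha_def alpha'_def by (rule card_mono[OF finite_tableaux]) auto

text \<open>Transposing rows and columns moves any cell to \<open>(n - 1, p - 1)\<close> and
  preserves saturation. The cell forced by the automaton is the pair of initial states, which this
  allows to be counted by \<open>alpha'\<close>.\<close>

lemma card_tableaux_with_cell:
  assumes "i < n" "j < p"
  shows "card {T \<in> tableaux n p. (i, j) \<in> T} = alpha' n p"
proof -
  let ?f = "transpose i (n - 1)" and ?g = "transpose j (p - 1)"
  let ?h = "\<lambda>T. map_prod ?f ?g ` T"
  have inv: "?h (?h T) = T" for T
    by (simp add: image_image map_prod.comp map_prod_def case_prod_unfold)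
  have sat: "saturated (?h T)" if "saturated T" for T
    by (rule saturated_image[where A = UNIV and B = UNIV]) (use that in auto)
  have sub: "?h T \<subseteq> {..<n} \<times> {..<p}" if "T \<subseteq> {..<n} \<times> {..<p}" for T
    using that assms by (auto simp: transpose_def)
  have "bij_betw ?h {T \<in> tableaux n p. (i, j) \<in> T} {T \<in> tableaux n p. (n - 1, p - 1) \<in> T}"
  proof (rule bij_betw_byWitness[where f' = ?h])
    show "?h ` {T \<in> tableaux n p. (i, j) \<in> T} \<subseteq> {T \<in> tableaux n p. (n - 1, p - 1) \<in> T}"
      using sat sub by (force simp: image_iff)
    show "?h ` {T \<in> tableaux n p. (n - 1, p - 1) \<in> T} \<subseteq> {T \<in> tableaux n p. (i, j) \<in> T}"
      using sat sub by (force simp: image_iff)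
  qed (simp_all only: inv, auto)
  then have "card {T \<in> tableaux n p. (i, j) \<in> T} = card {T \<in> tableaux n p. (n - 1, p - 1) \<in> T}"
    by (rule bij_betw_same_card)
  also have "\<dots> = alpha' n p" by (simp add: alpha'_def conj_assoc)
  finally show ?thesis .
qed

subsection \<open>The automaton of the concatenation with a symmetric difference\<close>

locale conc_symdiff_dfa =
  fixes d1 d2 d3 :: "nat \<Rightarrow> 'x \<Rightarrow> nat" and i1 i2 i3 :: nat and F1 F2 F3 :: "nat set"
    and m n p :: nat
  assumes dfa1: "is_dfa m d1 i1 F1" and dfa2: "is_dfa n d2 i2 F2" and dfa3: "is_dfa p d3 i3 F3"
begin

definition enter :: "nat \<Rightarrow> (nat \<times> nat) set" where
  "enter q = (if q \<in> F1 then {(i2, i3)} else {})"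

text \<open>A state \<open>(q, S)\<close> records the state of the first automaton and the pairs of states that
  the other two have reached on the possible second factors of the word read so far.\<close>

fun step :: "nat \<times> (nat \<times> nat) set \<Rightarrow> 'x \<Rightarrow> nat \<times> (nat \<times> nat) set" where
  "step (q, S) x = (d1 q x, map_prod (\<lambda>i. d2 i x) (\<lambda>j. d3 j x) ` S \<union> enter (d1 q x))"

definition accepting :: "nat \<times> (nat \<times> nat) set \<Rightarrow> bool" where
  "accepting s \<longleftrightarrow> (\<exists>(i, j) \<in> snd s. (i \<in> F2) \<noteq> (j \<in> F3))"

definition state_lang :: "nat \<times> (nat \<times> nat) set \<Rightarrow> 'x lang" where
  "state_lang s = {w. accepting (foldl step s w)}"

text \<open>Saturated tableaux represent classes of equivalent ones. Arrival in a final
  \<open>q\<close> marks the initial pair, so that cell is forced there; this is the source of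
  \<open>alpha'\<close> in the count.\<close>

definition states :: "(nat \<times> (nat \<times> nat) set) set" where
  "states = {(q, T). q < m \<and> T \<in> tableaux n p \<and> (q \<in> F1 \<longrightarrow> (i2, i3) \<in> T)}"

text \<open>Each factorisation \<open>w = u @ v\<close> with \<open>u\<close> leading to a final
  state contributes the pair reached on \<open>v\<close>. The empty \<open>u\<close> is excluded
  because \<open>step\<close> adds cells on arrival only; for the start state,
  \<open>enter i1\<close> accounts for it.\<close>

lemma foldl_step:
  "foldl step (q, S) w = (foldl d1 q w, map_prod (\<lambda>i. foldl d2 i w) (\<lambda>j. foldl d3 j w) ` S \<union>
     {(foldl d2 i2 v, foldl d3 i3 v) | u v. w = u @ v \<and> u \<noteq> [] \<and> foldl d1 q u \<in> F1})"
proof (induction w rule: rev_induct)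
  case Nil
  then show ?case by (auto simp: map_prod_def)
next
  case (snoc x w)
  let ?T = "\<lambda>w. {(foldl d2 i2 v, foldl d3 i3 v) | u v. w = u @ v \<and> u \<noteq> [] \<and> foldl d1 q u \<in> F1}"
  have "map_prod (\<lambda>i. d2 i x) (\<lambda>j. d3 j x) ` ?T w \<union> enter (foldl d1 q (w @ [x])) = ?T (w @ [x])"
    (is "?l = ?r")
  proof
    show "?l \<subseteq> ?r"
    proof
      fix z assume "z \<in> ?l"
      then consider u v where "z = (foldl d2 i2 (v @ [x]), foldl d3 i3 (v @ [x]))"
          "w = u @ v" "u \<noteq> []" "foldl d1 q u \<in> F1"
        | "z = (foldl d2 i2 [], foldl d3 i3 [])" "foldl d1 q (w @ [x]) \<in> F1"
        by (auto simp: enter_def split: if_splits)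
      then show "z \<in> ?r"
      proof cases
        case 1
        then show ?thesis by (intro CollectI exI[of _ u] exI[of _ "v @ [x]"]) auto
      next
        case 2
        then show ?thesis by (intro CollectI exI[of _ "w @ [x]"] exI[of _ "[]"]) auto
      qed
    qed
    show "?r \<subseteq> ?l"
    proof
      fix z assume "z \<in> ?r"
      then obtain u v where z: "z = (foldl d2 i2 v, foldl d3 i3 v)" "w @ [x] = u @ v" "u \<noteq> []"
        "foldl d1 q u \<in> F1" by blast
      show "z \<in> ?l"
      proof (cases v rule: rev_cases)
        case Nil
        then show ?thesis using z by (auto simp: enter_def)
      next
        case (snoc v' y)
        then have "z = map_prod (\<lambda>i. d2 i x) (\<lambda>j. d3 j x) (foldl d2 i2 v', foldl d3 i3 v')"
          "w = u @ v'" using z by auto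
        then show ?thesis using z by blast
      qed
    qed
  qed
  moreover have "map_prod (\<lambda>i. foldl d2 i (w @ [x])) (\<lambda>j. foldl d3 j (w @ [x])) ` S
    = map_prod (\<lambda>i. d2 i x) (\<lambda>j. d3 j x) ` map_prod (\<lambda>i. foldl d2 i w) (\<lambda>j. foldl d3 j w) ` S"
    by (auto simp: image_image map_prod_def case_prod_unfold)
  ultimately show ?case
    by (simp add: snoc image_Un Un_assoc)
qed

abbreviation start :: "nat \<times> (nat \<times> nat) set" where
  "start \<equiv> (i1, enter i1)"

lemma state_lang_start:
  "state_lang start = conc (dfa_lang d1 i1 F1) (symdiff (dfa_lang d2 i2 F2) (dfa_lang d3 i3 F3))"
    (is "_ = conc ?L ?D")
proof (rule set_eqI)
  fix w
  have D: "v \<in> ?D \<longleftrightarrow> (foldl d2 i2 v \<in> F2) \<noteq> (foldl d3 i3 v \<in> F3)" for v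
    by (auto simp: symdiff_def dfa_lang_def)
  have "w \<in> conc ?L ?D \<longleftrightarrow> (\<exists>u v. w = u @ v \<and> foldl d1 i1 u \<in> F1 \<and> v \<in> ?D)"
    by (auto simp: conc_def dfa_lang_def)
  also have "\<dots> \<longleftrightarrow> (i1 \<in> F1 \<and> w \<in> ?D) \<or>
      (\<exists>u v. w = u @ v \<and> u \<noteq> [] \<and> foldl d1 i1 u \<in> F1 \<and> v \<in> ?D)"
    by (metis append_Nil foldl_Nil)
  also have "\<dots> \<longleftrightarrow> w \<in> state_lang start"
    unfolding state_lang_def accepting_def foldl_step enter_def D by (auto; blast)
  finally show "w \<in> state_lang start \<longleftrightarrow> w \<in> conc ?L ?D" by simp
qed

lemma residual_start: "residual (state_lang start) w = state_lang (foldl step start w)"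
  by (simp add: residual_def state_lang_def)

text \<open>Cells added while reading \<open>w\<close> do not depend on the tableau. The old cells
  cause no acceptance iff they lie in a set of equally coloured cells; that set is saturated, so it
  contains the tableau iff it contains the saturation.\<close>

lemma state_lang_saturation: "state_lang (q, saturation S) = state_lang (q, S)"
proof (rule set_eqI)
  fix w
  let ?f = "\<lambda>i. foldl d2 i w \<in> F2" and ?g = "\<lambda>j. foldl d3 j w \<in> F3"
  have iff: "(\<exists>(i, j)\<in>S. ?f i \<noteq> ?g j) \<longleftrightarrow> \<not> S \<subseteq> {(i, j). ?f i = ?g j}" for S by auto
  have "saturation S \<subseteq> {(i, j). ?f i = ?g j} \<longleftrightarrow> S \<subseteq> {(i, j). ?f i = ?g j}"
    using saturation_least[OF _ saturated_equal_colour[of ?f ?g], of S] subset_saturation[of S]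
    by (auto dest: subsetD)
  then have *: "(\<exists>(i, j)\<in>saturation S. ?f i \<noteq> ?g j) \<longleftrightarrow> (\<exists>(i, j)\<in>S. ?f i \<noteq> ?g j)"
    unfolding iff by (rule arg_cong)
  have "(\<exists>(i, j)\<in>map_prod (\<lambda>i. foldl d2 i w) (\<lambda>j. foldl d3 j w) ` S. (i \<in> F2) \<noteq> (j \<in> F3))
    \<longleftrightarrow> (\<exists>(i, j)\<in>S. ?f i \<noteq> ?g j)" for S
    by (simp add: case_prod_unfold)
  then show "w \<in> state_lang (q, saturation S) \<longleftrightarrow> w \<in> state_lang (q, S)"
    using * unfolding state_lang_def accepting_def foldl_step by (simp add: bex_Un)
qed

lemma foldl_start:
  "foldl step start w \<in> {(q, S). q < m \<and> S \<subseteq> {..<n} \<times> {..<p} \<and> (q \<in> F1 \<longrightarrow> (i2, i3) \<in> S)}"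
proof (induction w rule: rev_induct)
  case Nil
  then show ?case using dfa1 dfa2 dfa3 by (auto simp: is_dfa_def enter_def)
next
  case (snoc x w)
  obtain q S where qS: "foldl step start w = (q, S)" by fastforce
  then have qS': "q < m" "S \<subseteq> {..<n} \<times> {..<p}" using snoc by auto
  then have "map_prod (\<lambda>i. d2 i x) (\<lambda>j. d3 j x) ` S \<subseteq> {..<n} \<times> {..<p}"
    using dfa2 dfa3 unfolding is_dfa_def by auto
  moreover have "enter (d1 q x) \<subseteq> {..<n} \<times> {..<p}"
    using dfa2 dfa3 unfolding is_dfa_def enter_def by simp
  moreover have "d1 q x < m" using qS' dfa1 unfolding is_dfa_def by simp
  moreover have "d1 q x \<in> F1 \<longrightarrow> (i2, i3) \<in> enter (d1 q x)" by (simp add: enter_def)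
  ultimately show ?case by (simp add: qS)
qed

lemma residuals_subset: "range (residual (state_lang start)) \<subseteq> state_lang ` states"
proof (rule image_subsetI)
  fix w
  obtain q S where qS: "foldl step start w = (q, S)" by fastforce
  then have *: "q < m" "S \<subseteq> {..<n} \<times> {..<p}" "q \<in> F1 \<longrightarrow> (i2, i3) \<in> S"
    using foldl_start[of w] by auto
  then have "(q, saturation S) \<in> states"
    unfolding states_def
    using saturated_saturation saturation_least[OF *(2) saturated_Times] subset_saturation by blast
  moreover have "residual (state_lang start) w = state_lang (q, saturation S)"
    by (simp add: residual_start qS state_lang_saturation)
  ultimately show "residual (state_lang start) w \<in> state_lang ` states" by blast
qed

lemma finite_states: "finite states"
  by (rule finite_subset[of _ "{..<m} \<times> tableaux n p"]) (auto simp: states_def finite_tableaux)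

lemma card_states: "card states = (m - card F1) * alpha n p + card F1 * alpha' n p"
proof -
  have F1: "F1 \<subseteq> {..<m}" using dfa1 by (simp add: is_dfa_def)
  then have "finite F1" using finite_lessThan by (rule finite_subset)
  note F1 = F1 this
  have "states = ({..<m} - F1) \<times> tableaux n p \<union> F1 \<times> {T \<in> tableaux n p. (i2, i3) \<in> T}"
    using F1 by (auto simp: states_def)
  also have "card \<dots> = card (({..<m} - F1) \<times> tableaux n p) + card (F1 \<times> {T \<in> tableaux n p. (i2, i3) \<in> T})"
    using F1 finite_tableaux by (intro card_Un_disjoint) auto
  also have "\<dots> = (m - card F1) * alpha n p + card F1 * alpha' n p"
  proof -
    have "card {T \<in> tableaux n p. (i2, i3) \<in> T} = alpha' n p"
      using dfa2 dfa3 by (intro card_tableaux_with_cell) (auto simp: is_dfa_def)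
    then show ?thesis
      using F1 by (simp only: card_cartesian_product card_Diff_subset card_lessThan alpha_def)
  qed
  finally show ?thesis .
qed

lemma finite_residuals: "finite (range (residual (state_lang start)))"
  using residuals_subset finite_states by (meson finite_imageI finite_subset)

lemma sc_le_card_states: "sc (state_lang start) \<le> card states"
  unfolding sc_eq_card_residuals[OF finite_residuals]
  using residuals_subset finite_states by (rule surj_card_le[rotated])

lemma sc_eq_card_states:
  assumes "\<And>s. s \<in> states \<Longrightarrow> \<exists>w. foldl step start w = s" "inj_on state_lang states"
  shows "sc (state_lang start) = card states"
proof (rule antisym[OF sc_le_card_states])
  have "state_lang ` states \<subseteq> range (residual (state_lang start))"
    using assms(1) residual_start by (metis image_subsetI rangeI)
  then have "card (state_lang ` states) \<le> sc (state_lang start)"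
    unfolding sc_eq_card_residuals[OF finite_residuals] by (rule card_mono[OF finite_residuals])
  then show "card states \<le> sc (state_lang start)"
    by (simp add: card_image[OF assms(2)])
qed

end

section \<open>The upper bound for arbitrary regular languages\<close>

lemma sc_empty: "sc {} = 1"
proof -
  have "range (residual ({} :: 'a lang)) = {{}}" by (auto simp: residual_def)
  then show ?thesis using sc_eq_card_residuals[of "{} :: 'a lang"] by simp
qed

text \<open>An empty \<open>F1\<close> would give the empty language, of state complexity 1. Each
  further final state replaces a summand \<open>alpha\<close> by \<open>alpha'\<close>, which is no
  larger, so a single final state is the worst case.\<close>

lemma sc_conc_symdiff_le:
  assumes "regular L1" "regular L2" "regular L3" "2 \<le> sc L1"
  shows "sc (conc L1 (symdiff L2 L3)) \<le>
    (sc L1 - 1) * alpha (sc L2) (sc L3) + alpha' (sc L2) (sc L3)"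
proof -
  obtain d1 i1 F1 where 1: "is_dfa (sc L1) d1 i1 F1" "dfa_lang d1 i1 F1 = L1"
    using dfa_with_sc_states[OF assms(1)] .
  obtain d2 i2 F2 where 2: "is_dfa (sc L2) d2 i2 F2" "dfa_lang d2 i2 F2 = L2"
    using dfa_with_sc_states[OF assms(2)] .
  obtain d3 i3 F3 where 3: "is_dfa (sc L3) d3 i3 F3" "dfa_lang d3 i3 F3 = L3"
    using dfa_with_sc_states[OF assms(3)] .
  interpret conc_symdiff_dfa d1 d2 d3 i1 i2 i3 F1 F2 F3 "sc L1" "sc L2" "sc L3"
    by (rule conc_symdiff_dfa.intro) (rule 1 2 3)+
  let ?A = "alpha (sc L2) (sc L3)" and ?A' = "alpha' (sc L2) (sc L3)"
  have "F1 \<noteq> {}"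
  proof
    assume "F1 = {}"
    then have "L1 = {}" using 1 by (auto simp: dfa_lang_def)
    then show False using assms(4) by (simp add: sc_empty)
  qed
  moreover have F1: "F1 \<subseteq> {..<sc L1}" using 1 by (simp add: is_dfa_def)
  ultimately obtain k where k: "card F1 = Suc k"
    by (metis card_0_eq finite_lessThan finite_subset not0_implies_Suc)
  have "card F1 \<le> sc L1" using card_mono[OF _ F1] by simp
  then obtain l where l: "sc L1 = Suc k + l" using k le_Suc_ex by metis
  have "sc (conc L1 (symdiff L2 L3)) \<le> (sc L1 - card F1) * ?A + card F1 * ?A'"
    using sc_le_card_states unfolding state_lang_start card_states 1 2 3 .
  also have "\<dots> = l * ?A + k * ?A' + ?A'" using k l by simp
  also have "\<dots> \<le> l * ?A + k * ?A + ?A'" using alpha'_le_alpha by simp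
  also have "\<dots> = (sc L1 - 1) * ?A + ?A'" using l by (simp add: algebra_simps)
  finally show ?thesis .
qed

subsection \<open>Colourings of rows and columns\<close>

text \<open>Conjugating the one given transposition by rotations yields every adjacent
  transposition, and conjugating adjacent ones yields all.\<close>

lemma closed_under_transpositions:
  fixes Q :: "(nat \<Rightarrow> 'c) \<Rightarrow> bool"
  assumes ext: "\<And>f g. Q f \<Longrightarrow> (\<And>i. i < n \<Longrightarrow> f i = g i) \<Longrightarrow> Q g"
    and rot: "\<And>f. Q f \<Longrightarrow> Q (\<lambda>i. f (Suc i mod n))"
    and swap: "\<And>f. Q f \<Longrightarrow> Q (f \<circ> transpose (n - 2) (n - 1))"
    and "2 \<le> n" "i < n" "j < n" "Q f"
  shows "Q (f \<circ> transpose i j)"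
proof -
  have rotk: "Q (\<lambda>i. f ((i + k) mod n))" if "Q f" for f k
  proof (induction k)
    case 0
    show ?case using that by (rule ext) simp
  next
    case (Suc k)
    from rot[OF this] show ?case by (rule ext) (simp add: mod_simps)
  qed
  have adj: "Q (f \<circ> transpose i (Suc i))" if "Q f" "Suc i < n" for f i
  proof -
    let ?t = "transpose (n - 2) (n - 1)"
    \<comment> \<open>The two rotations add up to \<open>n\<close>, and the one by
      \<open>n - 2 - i\<close> takes \<open>i\<close> and \<open>Suc i\<close> to
      \<open>n - 2\<close> and \<open>n - 1\<close>.\<close>
    have "Q (\<lambda>x. f ((?t ((x + (n - 2 - i)) mod n) + (i + 2)) mod n))"
      using rotk[OF swap[OF rotk[OF that(1), of "i + 2"]], of "n - 2 - i"] by (simp add: o_def)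
    then show ?thesis
    proof (rule ext)
      fix x assume x: "x < n"
      define y where "y = (x + (n - 2 - i)) mod n"
      have y: "(y + (i + 2)) mod n = x"
      proof -
        have "(y + (i + 2)) mod n = (x + (n - 2 - i) + (i + 2)) mod n"
          unfolding y_def by (rule mod_add_left_eq)
        also have "x + (n - 2 - i) + (i + 2) = x + n" using that by simp
        finally show ?thesis using x by simp
      qed
      have e1: "(n - 2 + (i + 2)) mod n = i"
      proof -
        have "n - 2 + (i + 2) = i + n" using assms(4) by simp
        then show ?thesis using that by (metis Suc_lessD mod_add_self2 mod_less)
      qed
      have e2: "(n - 1 + (i + 2)) mod n = Suc i"
      proof -
        have "n - 1 + (i + 2) = Suc i + n" using assms(4) by simp
        then show ?thesis using that by (metis mod_add_self2 mod_less)
      qed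
      have "(?t y + (i + 2)) mod n = transpose i (Suc i) x"
      proof (cases "y = n - 2 \<or> y = n - 1")
        case True
        then show ?thesis using y e1 e2 by (metis transpose_apply_first transpose_apply_second)
      next
        case False
        have "x \<noteq> i" "x \<noteq> Suc i"
        proof -
          show "x \<noteq> i"
          proof
            assume "x = i"
            then have "y = n - 2" unfolding y_def using that by simp
            with False show False by simp
          qed
          show "x \<noteq> Suc i"
          proof
            assume "x = Suc i"
            then have "y = n - 1" unfolding y_def using that by simp
            with False show False by simp
          qed
        qed
        then show ?thesis using False y by (simp add: transpose_def)
      qed
      then show "f ((?t ((x + (n - 2 - i)) mod n) + (i + 2)) mod n) = (f \<circ> transpose i (Suc i)) x"
        unfolding y_def by simp
    qed
  qed
  have up: "Q (f \<circ> transpose i j)" if "Q f" "i < j" "j < n" for f i j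
    using that
  proof (induction j arbitrary: f)
    case 0
    then show ?case by simp
  next
    case (Suc j)
    show ?case
    proof (cases "i = j")
      case True
      then show ?thesis using adj[OF Suc.prems(1,3)] by blast
    next
      case False
      have 1: "Q (f \<circ> transpose j (Suc j))" using adj[OF Suc.prems(1,3)] .
      have 2: "Q (f \<circ> transpose j (Suc j) \<circ> transpose i j)"
        by (rule Suc.IH[OF 1]) (use Suc False in auto)
      have 3: "Q (f \<circ> transpose j (Suc j) \<circ> transpose i j \<circ> transpose j (Suc j))"
        using adj[OF 2 Suc.prems(3)] .
      show ?thesis
        by (rule ext[OF 3]) (use Suc False in \<open>auto simp: transpose_def\<close>)
    qed
  qed
  consider "i < j" | "j < i" | "i = j" by linarith
  then show ?thesis
    using up[of f i j] up[of f j i] assms by cases (auto simp: transpose_commute)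
qed

text \<open>Closure properties of the pairs of colourings realised by words: prepending a word
  precomposes both colourings with its action. The rotations come from \<open>abb\<close> and
  \<open>d\<close>, each moving one component; \<open>b\<close> and \<open>c\<close> give the
  coupled \<open>swap\<close> and \<open>copy\<close>.\<close>

locale colour_pairs =
  fixes n p :: nat and Q :: "(nat \<Rightarrow> bool) \<Rightarrow> (nat \<Rightarrow> bool) \<Rightarrow> bool"
  assumes n3: "3 \<le> n" and p3: "3 \<le> p"
    and ext: "\<lbrakk>Q f g; \<And>i. i < n \<Longrightarrow> f i = f' i; \<And>j. j < p \<Longrightarrow> g j = g' j\<rbrakk> \<Longrightarrow> Q f' g'"
    and rot_left: "Q f g \<Longrightarrow> Q (\<lambda>i. f (Suc i mod n)) g"
    and rot_right: "Q f g \<Longrightarrow> Q f (\<lambda>j. g (Suc j mod p))"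
    and swap: "Q f g \<Longrightarrow> Q (f \<circ> transpose (n - 2) (n - 1)) (g \<circ> transpose (p - 2) (p - 1))"
    and copy: "Q f g \<Longrightarrow> Q (f(1 := f 0)) (g(1 := g 0))"
begin

text \<open>The assumptions are symmetric in rows and columns, so every lemma about the first
  component also serves the second.\<close>

lemma flip: "colour_pairs p n (\<lambda>g f. Q f g)"
  by unfold_locales (use n3 p3 ext rot_left rot_right swap copy in auto)

lemma rot_left_pow: "Q f g \<Longrightarrow> Q (\<lambda>i. f ((i + k) mod n)) g"
proof (induction k)
  case 0
  then show ?case by (rule ext) auto
next
  case (Suc k)
  from rot_left[OF Suc.IH[OF Suc.prems]] show ?case by (rule ext) (auto simp: mod_simps)
qed

text \<open>The commutator of the simultaneous swap with the rotation of the first component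
  acts trivially on the second component and as a 3-cycle on the first.\<close>

lemma three_cycle:
  assumes "Q f g"
  shows "Q (f(n - 2 := f (n - 1), n - 1 := f 0, 0 := f (n - 2))) g"
proof -
  let ?t = "transpose (n - 2) (n - 1)" and ?s = "transpose (p - 2) (p - 1)"
  have "Q (\<lambda>x. f (?t (Suc (?t ((x + (n - 1)) mod n)) mod n))) (g \<circ> ?s \<circ> ?s)"
    using rot_left_pow[OF swap[OF rot_left[OF swap[OF assms]]], of "n - 1"] by (simp add: o_def)
  then show ?thesis
  proof (rule ext)
    fix x assume x: "x < n"
    consider "x = 0" | "x = n - 1" "x \<noteq> 0" | "x = n - 2" "x \<noteq> 0" | "0 < x" "x < n - 2"
      using x by linarith
    then show "f (?t (Suc (?t ((x + (n - 1)) mod n)) mod n))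
      = (f(n - 2 := f (n - 1), n - 1 := f 0, 0 := f (n - 2))) x"
    proof cases
      case 1
      then show ?thesis using n3 by (simp add: transpose_def Suc_diff_Suc numeral_2_eq_2)
    next
      case 2
      then have "(x + (n - 1)) mod n = n - 2"
        using n3 by (simp add: mod_if)
      then show ?thesis using 2 n3 by (simp add: transpose_def)
    next
      case 3
      then have "(x + (n - 1)) mod n = n - 3"
        using n3 by (simp add: mod_if)
      moreover have "Suc (n - 3) = n - 2" using n3 by simp
      ultimately show ?thesis using 3 n3 by (auto simp: transpose_def)
    next
      case 4
      then have "(x + (n - 1)) mod n = x - 1"
        by (simp add: mod_if)
      then show ?thesis using 4 by (auto simp: transpose_def)
    qed
  qed auto
qed

text \<open>With only two colours, a transposition of differently coloured positions can be
  imitated by a 3-cycle or its square.\<close>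

lemma swap_left:
  assumes "Q f g"
  shows "Q (f \<circ> transpose (n - 2) (n - 1)) g"
proof -
  have ne: "n - 2 \<noteq> n - 1" "n - 2 \<noteq> 0" "n - 1 \<noteq> 0" using n3 by auto
  consider "f (n - 2) = f (n - 1)" | "f 0 = f (n - 2)" | "f 0 = f (n - 1)" by blast
  then show ?thesis
  proof cases
    case 1
    show ?thesis by (rule ext[OF assms]) (use 1 in \<open>auto simp: transpose_def\<close>)
  next
    case 2
    show ?thesis
      by (rule ext[OF three_cycle[OF assms]]) (use 2 ne in \<open>auto simp: transpose_def\<close>)
  next
    case 3
    show ?thesis
      by (rule ext[OF three_cycle[OF three_cycle[OF assms]]])
        (use 3 ne in \<open>auto simp: transpose_def\<close>)
  qed
qed

lemma transpose_left:
  assumes "Q f g" "i < n" "j < n"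
  shows "Q (f \<circ> transpose i j) g"
  by (rule closed_under_transpositions[where Q = "\<lambda>f. Q f g" and n = n])
    (use assms n3 swap_left rot_left ext in auto)

text \<open>Two of the first three columns share a colour; with these in positions 0 and 1, the
  coupled \<open>copy\<close> does not change the second colouring. Rows \<open>i\<close> and
  \<open>j\<close> are brought to 0 and 1 likewise, and the permutations are undone
  afterwards.\<close>

lemma copy_left:
  assumes "Q f g" "i < n" "j < n" "i \<noteq> j"
  shows "Q (f(j := f i)) g"
proof -
  interpret flip: colour_pairs p n "\<lambda>g f. Q f g" by (rule flip)
  obtain k l where kl: "k < p" "l < p" "k \<noteq> l" "g k = g l"
  proof -
    have "g 0 = g 1 \<or> g 0 = g 2 \<or> g 1 = g 2" by blast
    then show ?thesis using that[of 0 1] that[of 0 2] that[of 1 2] p3 by auto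
  qed
  \<comment> \<open>The place to which the first transposition moves \<open>j\<close>. It is not 0
    because \<open>i\<close> and \<open>j\<close> differ, so the second transposition leaves
    position 0 alone.\<close>
  define j' where "j' = transpose 0 i j"
  define l' where "l' = transpose 0 k l"
  have j': "j' < n" "j' \<noteq> 0" using assms n3 by (auto simp: j'_def transpose_def)
  have l': "l' < p" "l' \<noteq> 0" using kl p3 by (auto simp: l'_def transpose_def)
  let ?f = "f \<circ> transpose 0 i \<circ> transpose 1 j'"
  let ?g = "g \<circ> transpose 0 k \<circ> transpose 1 l'"
  have "Q ?f ?g"
    using assms kl j' l' n3 p3 by (intro transpose_left flip.transpose_left) auto
  then have "Q (?f(1 := ?f 0)) (?g(1 := ?g 0))" by (rule copy)
  then have "Q (?f(1 := ?f 0) \<circ> transpose 1 j' \<circ> transpose 0 i)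
               (?g(1 := ?g 0) \<circ> transpose 1 l' \<circ> transpose 0 k)"
    using assms kl j' l' n3 p3 by (intro transpose_left flip.transpose_left) auto
  then show ?thesis
    by (rule ext) (use assms kl in \<open>auto simp: j'_def l'_def transpose_def\<close>)
qed

text \<open>The single coloured row is moved to some \<open>i0\<close> with \<open>f i0\<close> and
  copied to the other rows that \<open>f\<close> colours; if \<open>f\<close> colours none, an
  uncoloured row is copied over it.\<close>

lemma all_left:
  assumes "Q (\<lambda>i. i = n - 1) g"
  shows "Q f g"
proof (cases "\<exists>i0 < n. f i0")
  case False
  have "Q ((\<lambda>i. i = n - 1)(n - 1 := (0 = n - 1))) g"
    using copy_left[OF assms, of 0 "n - 1"] n3 by simp
  then show ?thesis by (rule ext) (use False n3 in auto)
next
  case True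
  then obtain i0 where i0: "i0 < n" "f i0" by blast
  have base: "Q (\<lambda>i. i \<in> insert i0 {}) g"
    by (rule ext[OF transpose_left[OF assms, of "n - 1" i0]])
      (use i0 n3 in \<open>auto simp: transpose_def\<close>)
  have "Q (\<lambda>i. i \<in> insert i0 B) g" if "finite B" "B \<subseteq> {..<n}" for B
    using that
  proof (induction B rule: finite_induct)
    case empty
    then show ?case using base by simp
  next
    case (insert j B)
    then have "Q (\<lambda>i. i \<in> insert i0 B) g" by simp
    show ?case
    proof (cases "j = i0")
      case True
      then show ?thesis using insert by simp
    next
      case False
      then have "Q ((\<lambda>i. i \<in> insert i0 B)(j := i0 \<in> insert i0 B)) g"
        using copy_left[OF \<open>Q (\<lambda>i. i \<in> insert i0 B) g\<close>, of i0 j] insert.prems i0 by simp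
      then show ?thesis by (rule ext) auto
    qed
  qed
  from this[of "{i. i < n \<and> f i}"] have "Q (\<lambda>i. i \<in> insert i0 {i. i < n \<and> f i}) g"
    by auto
  then show ?thesis by (rule ext) (use i0 in auto)
qed

lemma all_pairs:
  assumes "Q (\<lambda>i. i = n - 1) (\<lambda>j. j = p - 1)"
  shows "Q f g"
proof -
  interpret flip: colour_pairs p n "\<lambda>g f. Q f g" by (rule flip)
  show ?thesis by (rule flip.all_left) (rule all_left[OF assms])
qed

end

subsection \<open>The witness automata\<close>

lemma W_delta_simps:
  assumes "distinct [x1, x2, x3, x4]"
  shows "W_delta k x1 x2 x3 x4 q x1 = Suc q mod k"
    "W_delta k x1 x2 x3 x4 q x2 = transpose (k - 2) (k - 1) q"
    "W_delta k x1 x2 x3 x4 q x3 = (if q = 1 then 0 else q)"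
    "W_delta k x1 x2 x3 x4 q x4 = q"
  using assms by (auto simp: W_delta_def transpose_def)

lemma is_dfa_W: "2 \<le> k \<Longrightarrow> is_dfa k (W_delta k x1 x2 x3 x4) 0 {k - 1}"
  by (auto simp: is_dfa_def W_delta_def)

lemma foldl_replicate_cycle:
  assumes "\<And>i. i < k \<Longrightarrow> delta i x = Suc i mod k" "q < k"
  shows "foldl delta q (replicate r x) = (q + r) mod k"
proof -
  have "0 < k" using assms(2) by simp
  then have "delta (i mod k) x = Suc i mod k" for i
    by (simp add: assms(1) mod_simps)
  then show ?thesis
    by (induction r) (use assms(2) in \<open>simp_all flip: replicate_append_same\<close>)
qed

lemma foldl_replicate_fixed:
  assumes "\<And>i. delta i x = i"
  shows "foldl delta q (replicate r x) = q"
  by (induction r) (simp_all add: assms)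

text \<open>The cycle letter suffices: \<open>q\<close> copies of \<open>x1\<close> reach
  \<open>q\<close>, and the power taking the larger of two states to \<open>k - 1\<close> leaves the
  smaller one short of it.\<close>

lemma sc_W_lang:
  assumes "2 \<le> k"
  shows "sc (W_lang k x1 x2 x3 x4) = k"
proof -
  let ?d = "W_delta k x1 x2 x3 x4"
  let ?l = "\<lambda>q. dfa_lang ?d q {k - 1}"
  have cyc: "foldl ?d q (replicate r x1) = (q + r) mod k" if "q < k" for q r
    by (rule foldl_replicate_cycle) (use that in \<open>simp_all add: W_delta_def\<close>)
  have "range (residual (W_lang k x1 x2 x3 x4)) = ?l ` {..<k}"
  proof
    show "range (residual (W_lang k x1 x2 x3 x4)) \<subseteq> ?l ` {..<k}"
      by (rule residuals_subset_states[OF is_dfa_W[OF assms]]) (simp add: W_lang_def)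
    show "?l ` {..<k} \<subseteq> range (residual (W_lang k x1 x2 x3 x4))"
    proof (rule image_subsetI)
      fix q assume "q \<in> {..<k}"
      then have "?l q = residual (W_lang k x1 x2 x3 x4) (replicate q x1)"
        using assms by (simp add: residual_def W_lang_def dfa_lang_def cyc)
      then show "?l q \<in> range (residual (W_lang k x1 x2 x3 x4))" by (rule range_eqI)
    qed
  qed
  moreover have "inj_on ?l {..<k}"
  proof (rule linorder_inj_onI)
    fix q q' assume q: "q < q'" "q \<in> {..<k}" "q' \<in> {..<k}"
    then have "replicate (k - 1 - q') x1 \<in> ?l q'" "replicate (k - 1 - q') x1 \<notin> ?l q"
      by (simp_all add: dfa_lang_def cyc)
    then show "?l q \<noteq> ?l q'" by metis
  qed auto
  ultimately show ?thesis
    using sc_eq_card_residuals[of "W_lang k x1 x2 x3 x4"] by (simp add: card_image)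
qed

locale witness =
  fixes m n p :: nat
  assumes m3: "3 \<le> m" and n3: "3 \<le> n" and p3: "3 \<le> p"
begin

declare One_nat_def [simp del]

abbreviation "dM \<equiv> W_delta m a c b d"
abbreviation "dN \<equiv> W_delta n a b c d"
abbreviation "dP \<equiv> W_delta p d b c a"
abbreviation "grid \<equiv> {..<n} \<times> {..<p}"

sublocale conc_symdiff_dfa dM dN dP 0 0 0 "{m - 1}" "{n - 1}" "{p - 1}" m n p
  by unfold_locales (use m3 n3 p3 in \<open>auto intro: is_dfa_W\<close>)

lemma delta_simps [simp]:
  "dM q a = Suc q mod m" "dM q b = (if q = 1 then 0 else q)"
  "dM q c = transpose (m - 2) (m - 1) q" "dM q d = q"
  "dN q a = Suc q mod n" "dN q b = transpose (n - 2) (n - 1) q"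
  "dN q c = (if q = 1 then 0 else q)" "dN q d = q"
  "dP q d = Suc q mod p" "dP q b = transpose (p - 2) (p - 1) q"
  "dP q c = (if q = 1 then 0 else q)" "dP q a = q"
  by (simp_all add: W_delta_simps)

lemma foldl_delta_less:
  "q < m \<Longrightarrow> foldl dM q w < m" "i < n \<Longrightarrow> foldl dN i w < n" "j < p \<Longrightarrow> foldl dP j w < p"
  using dfa1 dfa2 dfa3 by (induction w arbitrary: q i j) (auto simp: is_dfa_def)

abbreviation act :: "sigma list \<Rightarrow> (nat \<times> nat) set \<Rightarrow> (nat \<times> nat) set" where
  "act w S \<equiv> map_prod (\<lambda>i. foldl dN i w) (\<lambda>j. foldl dP j w) ` S"

lemma act_append: "act (u @ v) S = act v (act u S)"
  by (simp add: image_image map_prod_def case_prod_unfold)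

lemma act_grid: "S \<subseteq> grid \<Longrightarrow> act w S \<subseteq> grid"
  by (auto simp: foldl_delta_less dest!: subsetD)

text \<open>Words along which no cell is added. Only arrivals in the final state add one, so the
  starting state is not tested.\<close>

fun quiet :: "nat \<Rightarrow> sigma list \<Rightarrow> bool" where
  "quiet q [] \<longleftrightarrow> True"
| "quiet q (x # w) \<longleftrightarrow> dM q x \<noteq> m - 1 \<and> quiet (dM q x) w"

lemma quiet_append: "quiet q (u @ v) \<longleftrightarrow> quiet q u \<and> quiet (foldl dM q u) v"
  by (induction u arbitrary: q) auto

lemma foldl_step_quiet: "quiet q w \<Longrightarrow> foldl step (q, S) w = (foldl dM q w, act w S)"
proof (induction w arbitrary: q S)
  case Nil
  then show ?case by (auto simp: map_prod_def)
next
  case (Cons x w)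
  have "act w (act [x] S) = act ([x] @ w) S" by (rule act_append[symmetric])
  then show ?case using Cons by (simp add: enter_def)
qed

lemma foldl_step_grid:
  assumes "S \<subseteq> grid"
  obtains T where "foldl step (q, S) w = (foldl dM q w, T)" "T \<subseteq> grid"
proof (rule that)
  show "foldl step (q, S) w = (foldl dM q w, act w S \<union>
     {(foldl dN 0 v, foldl dP 0 v) | u v. w = u @ v \<and> u \<noteq> [] \<and> foldl dM q u \<in> {m - 1}})"
    by (rule foldl_step)
  show "act w S \<union> {(foldl dN 0 v, foldl dP 0 v) | u v. w = u @ v \<and> u \<noteq> [] \<and> foldl dM q u \<in> {m - 1}} \<subseteq> grid"
    using act_grid[OF assms, of w] foldl_delta_less n3 p3 by fastforce
qed

text \<open>The first \<open>a\<close> enters the final state and marks \<open>(0, 0)\<close>; the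
  second moves that cell one row on, \<open>a\<close> fixing the columns.\<close>

lemma foldl_step_aa: "foldl step (m - 2, S) [a, a] = (0, act [a, a] S \<union> {(1, 0)})"
proof -
  have "Suc (m - 2) = m - 1" using m3 by simp
  then show ?thesis
    using m3 n3 by (simp add: enter_def image_Un image_image map_prod_def case_prod_unfold)
qed

lemma quiet_replicate_a: "q + k < m - 1 \<Longrightarrow> quiet q (replicate k a)"
  by (induction k arbitrary: q) auto

lemma foldl_replicate:
  "q < m \<Longrightarrow> foldl dM q (replicate k a) = (q + k) mod m"
  "i < n \<Longrightarrow> foldl dN i (replicate k a) = (i + k) mod n"
  "j < p \<Longrightarrow> foldl dP j (replicate k d) = (j + k) mod p"
  by (simp_all add: foldl_replicate_cycle)

lemma foldl_replicate_id:
  "foldl dM q (replicate k d) = q" "foldl dN i (replicate k d) = i" "foldl dP j (replicate k a) = j"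
  by (simp_all add: foldl_replicate_fixed)

subsection \<open>All states are reachable\<close>

definition shift :: "nat \<Rightarrow> nat \<Rightarrow> (nat \<times> nat) set \<Rightarrow> (nat \<times> nat) set" where
  "shift k l S = map_prod (\<lambda>i. (i + k) mod n) (\<lambda>j. (j + l) mod p) ` S"

lemma shift_shift: "shift k l (shift k' l' S) = shift (k' + k) (l' + l) S"
  by (simp add: shift_def image_image map_prod_def case_prod_unfold mod_simps add.assoc)

lemma shift_grid: "shift k l S \<subseteq> grid"
  using n3 p3 by (auto simp: shift_def)

lemma shift_id: "S \<subseteq> grid \<Longrightarrow> n dvd k \<Longrightarrow> p dvd l \<Longrightarrow> shift k l S = S"
proof -
  assume S: "S \<subseteq> grid" and k: "n dvd k" and l: "p dvd l"
  have "map_prod (\<lambda>i. (i + k) mod n) (\<lambda>j. (j + l) mod p) x = x" if "x \<in> S" for x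
    using S k l that by (auto elim!: dvdE)
  then show ?thesis by (simp add: shift_def)
qed

lemma act_replicate_a: "S \<subseteq> grid \<Longrightarrow> act (replicate k a) S = shift k 0 S"
  unfolding shift_def by (rule image_cong) (auto simp: foldl_replicate foldl_replicate_id dest!: subsetD)

definition reach0 :: "(nat \<times> nat) set \<Rightarrow> bool" where
  "reach0 S \<longleftrightarrow> S \<subseteq> grid \<and> (\<exists>w. foldl step start w = (0, S))"

lemma reach0_foldl:
  assumes "reach0 S" "foldl step (0, S) w = (0, T)" "T \<subseteq> grid"
  shows "reach0 T"
  using assms unfolding reach0_def by (metis foldl_append)

lemma reach0_shift:
  assumes "reach0 S"
  shows "reach0 (shift k l S)"
proof -
  have S: "T \<subseteq> grid" if "reach0 T" for T using that by (simp add: reach0_def)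
  have 1: "reach0 (shift 1 0 T)" if "reach0 T" for T
  proof (rule reach0_foldl[OF that])
    \<comment> \<open>In the first automaton \<open>a\<close> sends 0 to 1 and \<open>b\<close>
      sends 1 back to 0; the second \<open>b\<close> undoes the swaps of rows and columns made by
      the first.\<close>
    have "quiet 0 [a, b, b]" "foldl dM 0 [a, b, b] = 0" using m3 by auto
    then have "foldl step (0, T) [a, b, b] = (0, act [a, b, b] T)"
      by (simp only: foldl_step_quiet)
    also have "act [a, b, b] T = shift 1 0 T"
      unfolding shift_def by (rule image_cong) (use S[OF that] in \<open>auto simp: One_nat_def dest!: subsetD\<close>)
    finally show "foldl step (0, T) [a, b, b] = (0, shift 1 0 T)" .
  qed (rule shift_grid)
  have 2: "reach0 (shift 0 1 T)" if "reach0 T" for T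
  proof (rule reach0_foldl[OF that])
    have "quiet 0 [d]" "foldl dM 0 [d] = 0" using m3 by simp_all
    then have "foldl step (0, T) [d] = (0, act [d] T)"
      by (simp only: foldl_step_quiet)
    also have "act [d] T = shift 0 1 T"
      unfolding shift_def by (rule image_cong) (use S[OF that] in \<open>auto simp: One_nat_def dest!: subsetD\<close>)
    finally show "foldl step (0, T) [d] = (0, shift 0 1 T)" .
  qed (rule shift_grid)
  have "reach0 (shift k 0 S)"
  proof (induction k)
    case 0
    then show ?case using assms by (simp add: shift_id S)
  next
    case (Suc k)
    from 1[OF this] show ?case by (simp add: shift_shift One_nat_def)
  qed
  then show ?thesis
  proof (induction l)
    case (Suc l)
    from 2[OF Suc.IH[OF Suc.prems]] show ?case by (simp add: shift_shift One_nat_def)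
  qed
qed

text \<open>A full turn of \<open>m\<close> letters \<open>a\<close>: the new cell appears on
  passing the final state, and the old ones are rotated by \<open>m\<close> rows.\<close>

lemma reach0_round:
  assumes "reach0 S"
  shows "reach0 (shift m 0 S \<union> {(1, 0)})"
proof (rule reach0_foldl[OF assms])
  have S: "S \<subseteq> grid" using assms by (simp add: reach0_def)
  have "foldl step (0, S) (replicate (m - 2) a) = (m - 2, act (replicate (m - 2) a) S)"
    using foldl_step_quiet[OF quiet_replicate_a] m3 by (simp add: foldl_replicate)
  then have "foldl step (0, S) (replicate (m - 2) a @ [a, a])
    = (0, act [a, a] (act (replicate (m - 2) a) S) \<union> {(1, 0)})"
    by (simp only: foldl_append foldl_step_aa)
  also have "act [a, a] (act (replicate (m - 2) a) S) = shift 2 0 (shift (m - 2) 0 S)"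
    using act_replicate_a[OF S] act_replicate_a[OF shift_grid, of 2 "m - 2" 0 S]
    by (simp only: numeral_2_eq_2 replicate.simps)
  also have "\<dots> = shift m 0 S" using m3 by (simp add: shift_shift del: add_2_eq_Suc')
  finally show "foldl step (0, S) (replicate (m - 2) a @ [a, a]) = (0, shift m 0 S \<union> {(1, 0)})" .
  show "shift m 0 S \<union> {(1, 0)} \<subseteq> grid" using shift_grid n3 p3 by simp
qed

text \<open>The tableau is rotated backwards in advance, so that a full turn and a last rotation
  restore it while taking the new cell from \<open>(1, 0)\<close> to \<open>(i, j)\<close>.\<close>

lemma reach0_insert:
  assumes "reach0 S" "i < n" "j < p"
  shows "reach0 (insert (i, j) S)"
proof -
  have S: "S \<subseteq> grid" using assms by (simp add: reach0_def)
  \<comment> \<open>This is \<open>i - 1\<close> modulo \<open>n\<close>; the factors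
    \<open>n - 1\<close> and \<open>p - 1\<close> below likewise express negation modulo
    \<open>n\<close> and \<open>p\<close>.\<close>
  define k where "k = i + (n - 1)"
  have "reach0 (shift k j (shift m 0 (shift ((n - 1) * (m + k)) ((p - 1) * j) S) \<union> {(1, 0)}))"
    by (intro reach0_shift reach0_round assms(1))
  also have "shift k j (shift m 0 (shift ((n - 1) * (m + k)) ((p - 1) * j) S) \<union> {(1, 0)})
    = shift k j (shift m 0 (shift ((n - 1) * (m + k)) ((p - 1) * j) S)) \<union> shift k j {(1, 0)}"
    by (simp add: shift_def image_Un)
  also have "shift k j (shift m 0 (shift ((n - 1) * (m + k)) ((p - 1) * j) S)) =
    shift ((n - 1) * (m + k) + m + k) ((p - 1) * j + 0 + j) S"
    by (simp only: shift_shift)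
  also have "\<dots> = S"
  proof (rule shift_id[OF S])
    have "(n - 1) * (m + k) + m + k = n * (m + k)" using n3 by (cases n) auto
    then show "n dvd (n - 1) * (m + k) + m + k" by simp
    have "(p - 1) * j + 0 + j = p * j" using p3 by (cases p) auto
    then show "p dvd (p - 1) * j + 0 + j" by simp
  qed
  also have "shift k j {(1, 0)} = {(i, j)}"
    using assms n3 by (simp add: shift_def k_def)
  finally show ?thesis by simp
qed

lemma reach0_all:
  assumes "S \<subseteq> grid"
  shows "reach0 S"
proof -
  have "finite S" using assms by (rule finite_subset) simp
  then show ?thesis using assms
  proof (induction S rule: finite_induct)
    case empty
    have "foldl step start [] = (0, {})" using m3 by (simp add: enter_def)
    then show ?case unfolding reach0_def by blast
  next
    case (insert x S)
    then show ?case using reach0_insert by (cases x) auto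
  qed
qed

text \<open>A suitably rotated tableau is reached over state 0, and \<open>q\<close> letters
  \<open>a\<close> turn it into \<open>T\<close>. Only for \<open>q = m - 1\<close> does this mark a
  cell, \<open>(0, 0)\<close>, and then \<open>T\<close> contains it.\<close>

lemma reachable:
  assumes "s \<in> states"
  shows "\<exists>w. foldl step start w = s"
proof -
  obtain q T where s: "s = (q, T)" by fastforce
  then have q: "q < m" and T: "T \<subseteq> grid" and cell: "q = m - 1 \<Longrightarrow> (0, 0) \<in> T"
    using assms by (auto simp: states_def)
  let ?S = "shift ((n - 1) * q) 0 T"
  have qq: "(n - 1) * q + q = n * q" using n3 by (cases n) auto
  have "shift q 0 ?S = T"
    unfolding shift_shift qq by (rule shift_id[OF T]) auto
  obtain u where u: "foldl step start u = (0, ?S)"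
    using reach0_all[OF shift_grid, of "(n - 1) * q" 0 T] unfolding reach0_def by blast
  have "foldl step (0, ?S) (replicate q a) = (q, T)"
  proof (cases "q = m - 1")
    case False
    then have "foldl step (0, ?S) (replicate q a) = (q, act (replicate q a) ?S)"
      using foldl_step_quiet[OF quiet_replicate_a] q by (simp add: foldl_replicate)
    then show ?thesis using \<open>shift q 0 ?S = T\<close> by (simp only: act_replicate_a[OF shift_grid])
  next
    case True
    then have q': "q = Suc (m - 2)" using m3 by simp
    have "foldl step (0, ?S) (replicate (m - 2) a) = (m - 2, act (replicate (m - 2) a) ?S)"
      using foldl_step_quiet[OF quiet_replicate_a] m3 by (simp add: foldl_replicate)
    then have "foldl step (0, ?S) (replicate (m - 2) a @ [a])
      = step (m - 2, act (replicate (m - 2) a) ?S) a"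
      by (simp only: foldl_append foldl.simps)
    also have "\<dots> = (q, act [a] (act (replicate (m - 2) a) ?S) \<union> {(0, 0)})"
    proof -
      have "dM (m - 2) a = q" using q' m3 by simp
      moreover have "enter q = {(0, 0)}" using True by (simp add: enter_def)
      ultimately show ?thesis by (simp only: step.simps foldl.simps)
    qed
    also have "act [a] (act (replicate (m - 2) a) ?S) = act (replicate q a) ?S"
      unfolding q' replicate_Suc replicate_append_same[symmetric] by (rule act_append[symmetric])
    also have "\<dots> = T" using \<open>shift q 0 ?S = T\<close> by (simp only: act_replicate_a[OF shift_grid])
    finally show ?thesis using cell[OF True] q' by (simp add: replicate_append_same insert_absorb)
  qed
  then show ?thesis using u s by (metis foldl_append)
qed

subsection \<open>Distinct states have distinct languages\<close>

lemma state_lang_neqI: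
  assumes "state_lang (foldl step s w) \<noteq> state_lang (foldl step s' w)"
  shows "state_lang s \<noteq> state_lang s'"
proof
  assume eq: "state_lang s = state_lang s'"
  have "state_lang (foldl step t w) = {v. w @ v \<in> state_lang t}" for t
    by (simp add: state_lang_def)
  then show False using assms eq by simp
qed

text \<open>The words considered lead from 0 to 0 without marking cells. From \<open>(0, S)\<close>
  such a word is accepted iff some cell of \<open>S\<close> has a row and a column of different
  colours.\<close>

definition realisable :: "(nat \<Rightarrow> bool) \<Rightarrow> (nat \<Rightarrow> bool) \<Rightarrow> bool" where
  "realisable f g \<longleftrightarrow> (\<exists>w. quiet 0 w \<and> foldl dM 0 w = 0 \<and>
     (\<forall>i<n. f i \<longleftrightarrow> foldl dN i w = n - 1) \<and> (\<forall>j<p. g j \<longleftrightarrow> foldl dP j w = p - 1))"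

lemma realisable_prepend:
  assumes "realisable f g" "quiet 0 u" "foldl dM 0 u = 0"
    and "\<And>i. i < n \<Longrightarrow> f' i = f (foldl dN i u)" "\<And>j. j < p \<Longrightarrow> g' j = g (foldl dP j u)"
  shows "realisable f' g'"
proof -
  obtain w where w: "quiet 0 w" "foldl dM 0 w = 0" "\<And>i. i < n \<Longrightarrow> f i \<longleftrightarrow> foldl dN i w = n - 1"
      "\<And>j. j < p \<Longrightarrow> g j \<longleftrightarrow> foldl dP j w = p - 1"
    using assms(1) unfolding realisable_def by blast
  have "quiet 0 (u @ w) \<and> foldl dM 0 (u @ w) = 0 \<and>
     (\<forall>i<n. f' i \<longleftrightarrow> foldl dN i (u @ w) = n - 1) \<and> (\<forall>j<p. g' j \<longleftrightarrow> foldl dP j (u @ w) = p - 1)"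
    using w assms(2-) by (simp add: quiet_append foldl_delta_less)
  then show ?thesis unfolding realisable_def by blast
qed

text \<open>Prepending \<open>abb\<close>, \<open>d\<close>, \<open>b\<close> and \<open>c\<close>
  gives the closure properties; \<open>c\<close> fixes state 0 of the first automaton because
  \<open>m - 2\<close> is positive. The empty word realises the colourings by final states.\<close>

lemma realisable_all: "realisable f g"
proof -
  interpret colour_pairs n p realisable
  proof unfold_locales
    show "3 \<le> n" "3 \<le> p" by (rule n3 p3)+
    fix f g
    show "realisable f' g'" if "realisable f g" "\<And>i. i < n \<Longrightarrow> f i = f' i" "\<And>j. j < p \<Longrightarrow> g j = g' j"
      for f' g'
      by (rule realisable_prepend[OF that(1), of "[]"]) (use that in auto)
    assume fg: "realisable f g"
    show "realisable (\<lambda>i. f (Suc i mod n)) g"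
      by (rule realisable_prepend[OF fg, of "[a, b, b]"]) (use m3 in auto)
    show "realisable f (\<lambda>j. g (Suc j mod p))"
      by (rule realisable_prepend[OF fg, of "[d]"]) (use m3 in auto)
    show "realisable (f \<circ> transpose (n - 2) (n - 1)) (g \<circ> transpose (p - 2) (p - 1))"
      by (rule realisable_prepend[OF fg, of "[b]"]) (use m3 in auto)
    show "realisable (f(1 := f 0)) (g(1 := g 0))"
      by (rule realisable_prepend[OF fg, of "[c]"]) (use m3 in \<open>auto simp: transpose_def\<close>)
  qed
  have "realisable (\<lambda>i. i = n - 1) (\<lambda>j. j = p - 1)"
    unfolding realisable_def by (rule exI[of _ "[]"]) simp
  then show ?thesis by (rule all_pairs)
qed

lemma state_lang_neq_colouring:
  fixes f g :: "nat \<Rightarrow> bool"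
  assumes "S \<subseteq> grid" "S' \<subseteq> grid" "\<And>i j. (i, j) \<in> S \<Longrightarrow> f i = g j" "(i, j) \<in> S'" "f i \<noteq> g j"
  shows "state_lang (0, S) \<noteq> state_lang (0, S')"
proof -
  obtain w where w: "quiet 0 w" "foldl dM 0 w = 0" "\<And>i. i < n \<Longrightarrow> f i \<longleftrightarrow> foldl dN i w = n - 1"
      "\<And>j. j < p \<Longrightarrow> g j \<longleftrightarrow> foldl dP j w = p - 1"
    using realisable_all[of f g] unfolding realisable_def by blast
  have acc: "w \<in> state_lang (0, T) \<longleftrightarrow> (\<exists>(i, j)\<in>T. f i \<noteq> g j)" if "T \<subseteq> grid" for T
  proof -
    have "w \<in> state_lang (0, T) \<longleftrightarrow> (\<exists>(i, j)\<in>T. (foldl dN i w = n - 1) \<noteq> (foldl dP j w = p - 1))"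
      using w(1) by (simp add: state_lang_def accepting_def foldl_step_quiet case_prod_unfold)
    also have "\<dots> \<longleftrightarrow> (\<exists>(i, j)\<in>T. f i \<noteq> g j)"
      by (rule bex_cong) (use that w(3,4) in auto)
    finally show ?thesis .
  qed
  have "w \<notin> state_lang (0, S)" unfolding acc[OF assms(1)] using assms(3) by auto
  moreover have "w \<in> state_lang (0, S')" unfolding acc[OF assms(2)] using assms(4,5) by auto
  ultimately show ?thesis by blast
qed

text \<open>In the second and third automata only \<open>c\<close> merges states; the other letters
  act as permutations.\<close>

lemma inj_on_delta:
  assumes "c \<notin> set w"
  shows "inj_on (\<lambda>i. foldl dN i w) {..<n}" "inj_on (\<lambda>j. foldl dP j w) {..<p}"
proof -
  have cyc: "inj_on (\<lambda>i. Suc i mod k) {..<k}" for k :: nat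
    by (rule inj_onI) (metis Suc_inject lessThan_iff mod_Suc mod_less nat.distinct(1))
  have tr: "inj_on (transpose x y) A" for x y :: nat and A
    by (rule inj_onI) (metis transpose_involutory)
  have N: "inj_on (\<lambda>i. dN i x) {..<n}" and P: "inj_on (\<lambda>j. dP j x) {..<p}" if "x \<noteq> c" for x
    using that by (cases x; simp add: cyc tr)+
  show "inj_on (\<lambda>i. foldl dN i w) {..<n}" using assms
  proof (induction w rule: rev_induct)
    case (snoc x w)
    then have "inj_on ((\<lambda>i. dN i x) \<circ> (\<lambda>i. foldl dN i w)) {..<n}"
      using foldl_delta_less by (intro comp_inj_on inj_on_subset[OF N]) auto
    then show ?case by (simp add: o_def)
  qed simp
  show "inj_on (\<lambda>j. foldl dP j w) {..<p}" using assms
  proof (induction w rule: rev_induct)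
    case (snoc x w)
    then have "inj_on ((\<lambda>i. dP i x) \<circ> (\<lambda>i. foldl dP i w)) {..<p}"
      using foldl_delta_less by (intro comp_inj_on inj_on_subset[OF P]) auto
    then show ?case by (simp add: o_def)
  qed simp
qed

text \<open>A colouring that separates \<open>S\<close> from \<open>S'\<close> is pushed forward
  along the injective action of \<open>w\<close> and separates the moved tableaux.\<close>

lemma state_lang_neq_act:
  assumes "c \<notin> set w" "S \<subseteq> grid" "S' \<subseteq> grid"
    and "\<And>i j. (i, j) \<in> S \<Longrightarrow> i \<in> R \<longleftrightarrow> j \<in> C" "(i, j) \<in> S'" "(i \<in> R) \<noteq> (j \<in> C)"
  shows "state_lang (0, act w S) \<noteq> state_lang (0, act w S')"
proof -
  let ?f = "\<lambda>x. x \<in> (\<lambda>i. foldl dN i w) ` (R \<inter> {..<n})"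
  let ?g = "\<lambda>y. y \<in> (\<lambda>j. foldl dP j w) ` (C \<inter> {..<p})"
  have f: "?f (foldl dN i w) \<longleftrightarrow> i \<in> R" if "i < n" for i
    using that inj_on_delta(1)[OF assms(1)] by (auto dest: inj_onD)
  have g: "?g (foldl dP j w) \<longleftrightarrow> j \<in> C" if "j < p" for j
    using that inj_on_delta(2)[OF assms(1)] by (auto dest: inj_onD)
  show ?thesis
  proof (rule state_lang_neq_colouring[where f = ?f and g = ?g])
    show "?f x = ?g y" if "(x, y) \<in> act w S" for x y
    proof -
      obtain i j where ij: "(i, j) \<in> S" "x = foldl dN i w" "y = foldl dP j w" using \<open>(x, y) \<in> _\<close> by auto
      then have "i < n" "j < p" using assms(2) by auto
      then show ?thesis unfolding ij(2,3) using f g assms(4)[OF ij(1)] by blast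
    qed
    show "(foldl dN i w, foldl dP j w) \<in> act w S'" using assms(5) by force
    have "i < n" "j < p" using assms(3,5) by auto
    then show "?f (foldl dN i w) \<noteq> ?g (foldl dP j w)" using f g assms(6) by blast
  qed (rule act_grid assms)+
qed

lemma act_tableaux:
  assumes "c \<notin> set w" "T \<in> tableaux n p"
  shows "act w T \<in> tableaux n p"
proof -
  have T: "T \<subseteq> grid" "saturated T" using assms(2) by auto
  show ?thesis using act_grid[OF T(1)] saturated_image[OF inj_on_delta[OF assms(1)] T] by simp
qed

lemma act_inj:
  assumes "c \<notin> set w" "S \<subseteq> grid" "S' \<subseteq> grid" "S \<noteq> S'"
  shows "act w S \<noteq> act w S'"
proof -
  have "inj_on (map_prod (\<lambda>i. foldl dN i w) (\<lambda>j. foldl dP j w)) grid"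
    using inj_on_delta[OF assms(1)] by (rule map_prod_inj_on)
  then show ?thesis using assms(2-) by (simp add: inj_on_image_eq_iff)
qed

text \<open>On the way from \<open>m - 2\<close> back to \<open>0\<close> the first automaton passes through its final state,
  so a new cell is marked. Which cell it is can be steered within the last two rows, and one of
  these is compatible with a colouring that separates the tableaux.\<close>

lemma state_lang_neq_penultimate:
  assumes "4 \<le> m" "S \<in> tableaux n p" "S' \<in> tableaux n p" "(i, j) \<in> S'" "(i, j) \<notin> S"
  shows "state_lang (m - 2, S) \<noteq> state_lang (m - 2, S')"
proof -
  have grid: "S \<subseteq> grid" "S' \<subseteq> grid" "saturated S" using assms by auto
  have ij: "i < n" "j < p" using assms(4) grid by auto
  obtain R C where RC: "\<And>x y. (x, y) \<in> S \<Longrightarrow> x \<in> R \<longleftrightarrow> y \<in> C" "i \<in> R" "j \<notin> C" "C = {} \<Longrightarrow> R = {i}"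
      "\<And>y. y \<in> C \<Longrightarrow> (i, y) \<in> S"
    using separating_colouring[OF grid(3) assms(5)] by metis
  \<comment> \<open>A cell in the last two rows that respects the colouring. The uncoloured column
    \<open>j\<close> suits an uncoloured row. If \<open>n - 1\<close> is coloured, a column of
    \<open>C\<close> is taken; if \<open>C\<close> is empty, then \<open>R = {n - 1}\<close> and row
    \<open>n - 2\<close> is uncoloured.\<close>
  obtain r y where ry: "r = n - 1 \<or> r = n - 2" "y < p" "r \<in> R \<longleftrightarrow> y \<in> C"
  proof (cases "n - 1 \<in> R")
    case False
    then show ?thesis using that[of "n - 1" j] RC ij by blast
  next
    case True
    show ?thesis
    proof (cases "C = {}")
      case C: True
      then have "n - 2 \<notin> R" using True RC(4) n3 by auto
      then show ?thesis using that[of "n - 2" j] RC(3) ij by blast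
    next
      case False
      then obtain y where "y \<in> C" by blast
      moreover have "y < p" using RC(5)[OF \<open>y \<in> C\<close>] grid(1) by auto
      ultimately show ?thesis using that[of "n - 1" y] True by blast
    qed
  qed
  \<comment> \<open>If needed, \<open>b\<close> takes row \<open>n - 2\<close> to
    \<open>n - 1\<close>, fixing \<open>m - 2\<close> as \<open>4 \<le> m\<close>; then
    \<open>k\<close> letters \<open>d\<close> take the column to 0. Under \<open>aa\<close> row
    \<open>n - 1\<close> goes to 1, so \<open>(r, y)\<close> lands on the newly marked cell
    \<open>(1, 0)\<close>, as if it had been in the tableau from the outset.\<close>
  define u where "u = (if r = n - 1 then [] else [b])"
  define k where "k = p - foldl dP y u"
  define w where "w = u @ replicate k d @ [a, a]"
  have w: "c \<notin> set w" by (auto simp: w_def u_def)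
  have q: "quiet (m - 2) (u @ replicate k d)" "foldl dM (m - 2) (u @ replicate k d) = m - 2"
  proof -
    have "quiet (m - 2) (replicate k d)" using m3 by (induction k) auto
    then show "quiet (m - 2) (u @ replicate k d)" "foldl dM (m - 2) (u @ replicate k d) = m - 2"
      using assms(1) by (auto simp: u_def quiet_append foldl_replicate_id)
  qed
  have cell: "(foldl dN r w, foldl dP y w) = (1, 0)"
  proof -
    have "foldl dN r u = n - 1" using ry(1) n3 by (auto simp: u_def)
    then have "foldl dN r w = 1" using n3 by (simp add: w_def foldl_replicate_id)
    moreover have "foldl dP y u < p" using ry(2) by (rule foldl_delta_less)
    then have "foldl dP y w = 0" by (simp add: w_def foldl_replicate k_def)
    ultimately show ?thesis by simp
  qed
  have run: "foldl step (m - 2, T) w = (0, act w (insert (r, y) T))" for T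
  proof -
    have "foldl step (m - 2, T) ((u @ replicate k d) @ [a, a])
      = (0, act [a, a] (act (u @ replicate k d) T) \<union> {(1, 0)})"
      unfolding foldl_append[of _ _ "u @ replicate k d"] foldl_step_quiet[OF q(1)] q(2) foldl_step_aa ..
    also have "act [a, a] (act (u @ replicate k d) T) = act w T"
      unfolding w_def append_assoc[symmetric] by (rule act_append[symmetric])
    also have "act w T \<union> {(1, 0)} = act w (insert (r, y) T)"
      using cell by simp
    finally show ?thesis by (simp add: w_def)
  qed
  have r: "r < n" using ry n3 by auto
  show ?thesis
  proof (rule state_lang_neqI[where w = w])
    show "state_lang (foldl step (m - 2, S) w) \<noteq> state_lang (foldl step (m - 2, S') w)"
      unfolding run
      by (rule state_lang_neq_act[OF w, where R = R and C = C and i = i and j = j])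
        (use grid r ry RC assms in auto)
  qed
qed

text \<open>Letters acting as permutations keep saturated tableaux distinct and saturated, so the
  first automaton can be steered to 0, where a separating colouring is realised.\<close>

lemma state_lang_neq_tableaux:
  assumes "q < m" "S \<in> tableaux n p" "S' \<in> tableaux n p" "S \<noteq> S'"
  shows "state_lang (q, S) \<noteq> state_lang (q, S')"
  using assms
proof (induction "m - q" arbitrary: q S S' rule: less_induct)
  case less
  have zero: "state_lang (0, S) \<noteq> state_lang (0, S')"
    if "S \<in> tableaux n p" "S' \<in> tableaux n p" "(i, j) \<in> S'" "(i, j) \<notin> S" for S S' i j
  proof -
    have sat: "saturated S" using that(1) by simp
    obtain R C where RC: "\<And>x y. (x, y) \<in> S \<Longrightarrow> x \<in> R \<longleftrightarrow> y \<in> C" "i \<in> R" "j \<notin> C"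
        "C = {} \<Longrightarrow> R = {i}" "\<And>y. y \<in> C \<Longrightarrow> (i, y) \<in> S"
      using separating_colouring[OF sat \<open>(i, j) \<notin> S\<close>] by metis
    show ?thesis
      by (rule state_lang_neq_colouring[of _ _ "\<lambda>i. i \<in> R" "\<lambda>j. j \<in> C" i j]) (use RC that in auto)
  qed
  have zero': "state_lang (0, S) \<noteq> state_lang (0, S')"
    if "S \<in> tableaux n p" "S' \<in> tableaux n p" "S \<noteq> S'" for S S'
  proof -
    from \<open>S \<noteq> S'\<close> obtain i j where "(i, j) \<in> S' \<and> (i, j) \<notin> S \<or> (i, j) \<in> S \<and> (i, j) \<notin> S'" by auto
    then show ?thesis using zero[of S S' i j] zero[of S' S i j] that(1,2) by metis
  qed
  have letter: "state_lang (q, S) \<noteq> state_lang (q, S')"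
    if "x \<noteq> c" "dM q x \<noteq> m - 1"
      "\<And>T T'. T \<in> tableaux n p \<Longrightarrow> T' \<in> tableaux n p \<Longrightarrow> T \<noteq> T' \<Longrightarrow>
        state_lang (dM q x, T) \<noteq> state_lang (dM q x, T')" for x
  proof (rule state_lang_neqI[where w = "[x]"])
    have x: "c \<notin> set [x]" using that(1) by simp
    have "foldl step (q, T) [x] = (dM q x, act [x] T)" for T
      using foldl_step_quiet[of q "[x]"] that(2) by simp
    moreover have "act [x] S \<noteq> act [x] S'"
      by (rule act_inj[OF x]) (use less.prems in auto)
    ultimately show "state_lang (foldl step (q, S) [x]) \<noteq> state_lang (foldl step (q, S') [x])"
      using that(3)[OF act_tableaux[OF x less.prems(2)] act_tableaux[OF x less.prems(3)]] by simp
  qed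
  \<comment> \<open>For \<open>m = 3\<close> the state \<open>m - 2\<close> is 1, which
    \<open>b\<close> sends to 0 without marking a cell; the fourth case thus has
    \<open>4 \<le> m\<close>.\<close>
  consider "q = 0" | "q = 1" | "q = m - 1" | "q = m - 2" "2 \<le> q" | "2 \<le> q" "Suc q < m - 1"
    using less.prems(1) by linarith
  then show ?case
  proof cases
    case 1
    then show ?thesis using zero' less.prems by blast
  next
    case 2
    show ?thesis by (rule letter[of b]) (use 2 m3 zero' in auto)
  next
    case 3
    show ?thesis by (rule letter[of a]) (use 3 m3 zero' in auto)
  next
    case 4
    from less.prems(4) obtain i j
      where ij: "(i, j) \<in> S' \<and> (i, j) \<notin> S \<or> (i, j) \<in> S \<and> (i, j) \<notin> S'" by auto
    have "4 \<le> m" using 4 by linarith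
    then show ?thesis
      using ij state_lang_neq_penultimate[of S S' i j] state_lang_neq_penultimate[of S' S i j]
        less.prems(2,3) unfolding 4(1) by metis
  next
    case 5
    then have "dM q a = Suc q" by simp
    then show ?thesis using 5 less.hyps[of "Suc q"] by (intro letter[of a]) simp_all
  qed
qed

section \<open>Separating different states of the first automaton\<close>

text \<open>The word \<open>ccd\<^sup>p\<^sup>-\<^sup>1ab\<close> empties column \<open>0\<close>, except for cells that are marked while
  it is read, and only a run from the final state marks any.\<close>

lemma state_lang_neq_final_zero:
  assumes "S \<subseteq> grid" "S' \<subseteq> grid"
  shows "state_lang (0, S) \<noteq> state_lang (m - 1, S')"
proof -
  \<comment> \<open>The letter \<open>c\<close> merges column 1 into 0, and \<open>p - 1\<close>
    rotations bring the vacated column to 0. The second \<open>c\<close> returns the other run to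
    \<open>m - 1\<close>, so that it marks \<open>(0, 0)\<close> at the end of \<open>u\<close>;
    \<open>ab\<close> then takes both runs to state 0 and keeps column 0.\<close>
  define u where "u = [c, c] @ replicate (p - 1) d"
  let ?w = "u @ [a, b]"
  have M: "transpose (m - 2) (m - 1) 0 = 0" using m3 by (simp add: transpose_def)
  have qd: "quiet 0 (replicate k d)" for k using m3 by (induction k) auto
  have q: "quiet 0 ?w" "foldl dM 0 ?w = 0"
    using m3 qd by (simp_all add: u_def quiet_append foldl_replicate_id M)
  have "foldl dP j ?w \<noteq> 0" if "j < p" for j
  proof -
    define j' where "j' = (if j = 1 then 0 else j)"
    have j': "j' < p" "j' \<noteq> 1" using that by (auto simp: j'_def)
    have "foldl dP j [c, c] = j'" by (simp add: j'_def)
    then have u: "foldl dP j u = (j' + (p - 1)) mod p"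
      using j'(1) by (simp add: u_def foldl_replicate)
    have "(j' + (p - 1)) mod p \<noteq> 0"
    proof (cases "j' = 0")
      case True
      then show ?thesis using p3 by simp
    next
      case False
      then have "(j' + (p - 1)) mod p = j' - 1" using j' by (simp add: mod_if)
      then show ?thesis using False j' by simp
    qed
    then show ?thesis using u p3 by (simp add: transpose_def)
  qed
  then have zero: "y \<noteq> 0" if "(x, y) \<in> act ?w S" for x y
    using that assms(1) by auto
  obtain T where T: "foldl step (m - 1, S') ?w = (foldl dM (m - 1) ?w, T)" "T \<subseteq> grid"
    using foldl_step_grid[OF assms(2)] .
  have u1: "foldl dM (m - 1) u = m - 1" by (simp add: u_def foldl_replicate_id)
  then have end0: "foldl dM (m - 1) ?w = 0" using m3 by simp
  have "(foldl dN 0 [a, b], foldl dP 0 [a, b]) \<in> T"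
  proof -
    have "(foldl dN 0 [a, b], foldl dP 0 [a, b]) \<in> snd (foldl step (m - 1, S') ?w)"
      unfolding foldl_step snd_conv
      by (intro UnI2 CollectI exI[of _ u] exI[of _ "[a, b]"]) (simp add: u1, simp add: u_def)
    then show ?thesis using T by simp
  qed
  moreover have "foldl dP 0 [a, b] = 0" using p3 by (simp add: transpose_def)
  ultimately have in_T: "(foldl dN 0 [a, b], 0) \<in> T" by simp
  have "state_lang (0, act ?w S) \<noteq> state_lang (0, T)"
  proof (rule state_lang_neq_colouring[OF act_grid[OF assms(1)] T(2)])
    \<comment> \<open>No row is coloured, and only column 0 is.\<close>
    show "False = (y = 0)" if "(x, y) \<in> act ?w S" for x y using zero[OF that] by simp
    show "(foldl dN 0 [a, b], 0) \<in> T" by (rule in_T)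
  qed simp
  then have "state_lang (foldl step (0, S) ?w) \<noteq> state_lang (foldl step (m - 1, S') ?w)"
    unfolding foldl_step_quiet[OF q(1)] q(2) T(1) end0 .
  then show ?thesis by (rule state_lang_neqI)
qed

text \<open>The word \<open>abb\<close> returns 0 to 0 but advances \<open>k\<close> by one if
  \<open>0 < k < m - 1\<close>, since \<open>b\<close> moves only state 1; repetition reduces to
  \<open>k = m - 1\<close>.\<close>

lemma state_lang_neq_zero:
  assumes "0 < k" "k < m" "S \<subseteq> grid" "S' \<subseteq> grid"
  shows "state_lang (0, S) \<noteq> state_lang (k, S')"
  using assms
proof (induction "m - k" arbitrary: k S S' rule: less_induct)
  case less
  show ?case
  proof (cases "k = m - 1")
    case True
    then show ?thesis using state_lang_neq_final_zero less.prems by simp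
  next
    case False
    obtain T where T: "foldl step (0, S) [a, b, b] = (foldl dM 0 [a, b, b], T)" "T \<subseteq> grid"
      using foldl_step_grid[OF less.prems(3)] .
    obtain T' where T': "foldl step (k, S') [a, b, b] = (foldl dM k [a, b, b], T')" "T' \<subseteq> grid"
      using foldl_step_grid[OF less.prems(4)] .
    have eq: "foldl dM 0 [a, b, b] = 0" "foldl dM k [a, b, b] = Suc k"
      using m3 False less.prems by simp_all
    have "state_lang (0, T) \<noteq> state_lang (Suc k, T')"
      using less.hyps[of "Suc k" T T'] False less.prems T T' by linarith
    then have "state_lang (foldl step (0, S) [a, b, b]) \<noteq> state_lang (foldl step (k, S') [a, b, b])"
      unfolding T(1) T'(1) eq .
    then show ?thesis by (rule state_lang_neqI)
  qed
qed

text \<open>A power of \<open>a\<close> takes \<open>q'\<close> to 0 and the smaller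
  \<open>q\<close> to a nonzero state.\<close>

lemma state_lang_neq_first:
  assumes "q < q'" "q' < m" "S \<subseteq> grid" "S' \<subseteq> grid"
  shows "state_lang (q, S) \<noteq> state_lang (q', S')"
proof (rule state_lang_neqI)
  let ?w = "replicate (m - q') a"
  obtain T where T: "foldl step (q, S) ?w = (foldl dM q ?w, T)" "T \<subseteq> grid"
    using foldl_step_grid[OF assms(3)] .
  obtain T' where T': "foldl step (q', S') ?w = (foldl dM q' ?w, T')" "T' \<subseteq> grid"
    using foldl_step_grid[OF assms(4)] .
  have eq: "foldl dM q' ?w = 0" "foldl dM q ?w = q + (m - q')"
    using assms by (simp_all add: foldl_replicate)
  have "state_lang (0, T') \<noteq> state_lang (q + (m - q'), T)"
    by (rule state_lang_neq_zero) (use assms T T' in auto)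
  then show "state_lang (foldl step (q, S) ?w) \<noteq> state_lang (foldl step (q', S') ?w)"
    unfolding T(1) T'(1) eq by (rule not_sym)
qed

lemma inj_on_state_lang: "inj_on state_lang states"
proof (rule inj_onI, rule ccontr)
  fix s s' assume s: "s \<in> states" "s' \<in> states" "state_lang s = state_lang s'" "s \<noteq> s'"
  obtain q S q' S' where e: "s = (q, S)" "s' = (q', S')" by fastforce
  then have states: "q < m" "q' < m" "S \<in> tableaux n p" "S' \<in> tableaux n p"
    using s unfolding states_def by auto
  then have grid: "S \<subseteq> grid" "S' \<subseteq> grid" by auto
  consider "q < q'" | "q' < q" | "q = q'" "S \<noteq> S'" using s(4) e by force
  then have "state_lang (q, S) \<noteq> state_lang (q', S')"
  proof cases
    case 1
    then show ?thesis using states(2) grid by (rule state_lang_neq_first)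
  next
    case 2
    then show ?thesis using states(1) grid(2,1) by (intro not_sym[OF state_lang_neq_first])
  next
    case 3
    then show ?thesis using states by (simp only:) (rule state_lang_neq_tableaux)
  qed
  then show False using s(3) e by simp
qed

section \<open>The witnesses attain the bound\<close>

lemma sc_witness:
  "sc (conc (W_lang m a c b d) (symdiff (W_lang n a b c d) (W_lang p d b c a)))
    = (m - 1) * alpha n p + alpha' n p"
  using sc_eq_card_states[OF reachable inj_on_state_lang]
  unfolding state_lang_start card_states W_lang_def by (simp add: One_nat_def)

end

theorem theorem4:
  fixes m n p :: nat
  assumes "m \<ge> 3" "n \<ge> 3" "p \<ge> 3"
  defines "M \<equiv> W_lang m a c b d"
      and "N \<equiv> W_lang n a b c d"
      and "P \<equiv> W_lang p d b c a"
  shows "sc M = m \<and> sc N = n \<and> sc P = p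
    \<and> sc (conc M (symdiff N P)) = (m - 1) * alpha n p + alpha' n p
    \<and> (\<forall>L1 L2 L3 :: sigma lang. regular L1 \<and> regular L2 \<and> regular L3 \<and>
          sc L1 = m \<and> sc L2 = n \<and> sc L3 = p \<longrightarrow>
          sc (conc L1 (symdiff L2 L3)) \<le> (m - 1) * alpha n p + alpha' n p)"
proof (intro conjI allI impI)
  interpret witness m n p by unfold_locales (rule assms)+
  show "sc M = m" "sc N = n" "sc P = p"
    using assms(1-3) by (simp_all add: M_def N_def P_def sc_W_lang)
  show "sc (conc M (symdiff N P)) = (m - 1) * alpha n p + alpha' n p"
    unfolding M_def N_def P_def by (rule sc_witness)
  fix L1 L2 L3 :: "sigma lang"
  assume "regular L1 \<and> regular L2 \<and> regular L3 \<and> sc L1 = m \<and> sc L2 = n \<and> sc L3 = p"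
  then show "sc (conc L1 (symdiff L2 L3)) \<le> (m - 1) * alpha n p + alpha' n p"
    using sc_conc_symdiff_le[of L1 L2 L3] assms(1) by auto
qed

end
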